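(* Let $n\in\mathbb{N}$ and $1\le k<n$ be integers, and let $G_{n,k}=(V,E)$ be the directed graph with node set $V=\{1,\dots,n\}$ and arc set $E=\{(i,j)\in[n]\times[n]: 1\le j-i\le k\}$. Then for any supply vector $b$, the diameter of the graph of the singly-capacitated network flow polytope $P$ of $G_{n,k}$ with supply vector $b$ is at most $2|E|$.
   Context: For a directed acyclic graph $G=(N,A)$ and $b:N\to\mathbb{R}$, the singly-capacitated network flow polytope is the set of $x=(x_{i,j})_{(i,j)\in A}$ with $x_{i,j}\ge0$ for all arcs and $\sum_{\{j:(i,j)\in A\}}x_{i,j}-\sum_{\{j:(j,i)\in A\}}x_{j,i}=b(i)$ for every node $i\in N$. The diameter of a polytope is the diameter of its graph (vertices and edges of the polytope). *)

theory Defs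
  imports "HOL-Analysis.Analysis" "HOL-Library.Extended_Nat"
begin

definition band_nodes :: "nat \<Rightarrow> nat set" where
  "band_nodes n = {1..n}"

(* The truncated subtraction on nat is harmless: 1 <= j - i forces i < j. *)
definition band_arcs :: "nat \<Rightarrow> nat \<Rightarrow> (nat \<times> nat) set" where
  "band_arcs n k = {(i, j). i \<in> {1..n} \<and> j \<in> {1..n} \<and> 1 \<le> j - i \<and> j - i \<le> k}"

lemma acyclic_band_arcs: "acyclic (band_arcs n k)"
proof (rule acyclic_subset)
  show "acyclic less_than"
    by (simp add: wf_acyclic)
  show "band_arcs n k \<subseteq> less_than"
    by (auto simp: band_arcs_def)
qed

(* The coordinates of the flow space real ^ 'e are indexed by a finite type 'e; the map ends
   gives the arc (tail, head) that belongs to an index.  For a digraph (N, A), ends is to be a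
   bijection from 'e onto A, so that real ^ 'e is the space of vectors indexed by A. *)
definition flow_polytope ::
    "'v set \<Rightarrow> ('e::finite \<Rightarrow> 'v \<times> 'v) \<Rightarrow> ('v \<Rightarrow> real) \<Rightarrow> (real ^ 'e) set" where
  "flow_polytope N ends b =
     {x. (\<forall>e. 0 \<le> x $ e) \<and>
         (\<forall>i\<in>N. (\<Sum>e | fst (ends e) = i. x $ e) - (\<Sum>e | snd (ends e) = i. x $ e) = b i)}"

definition polytope_vertices :: "'a::euclidean_space set \<Rightarrow> 'a set" where
  "polytope_vertices P = {v. v extreme_point_of P}"

definition polytope_adj :: "'a::euclidean_space set \<Rightarrow> ('a \<times> 'a) set" where
  "polytope_adj P = {(u, v). u \<in> polytope_vertices P \<and> v \<in> polytope_vertices P \<and>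
                             closed_segment u v edge_of P}"

(* The least length of a walk from u to v; infinity (the infimum of the empty set) if there
   is no walk. *)
definition graph_dist :: "('a \<times> 'a) set \<Rightarrow> 'a \<Rightarrow> 'a \<Rightarrow> enat" where
  "graph_dist R u v = (INF d \<in> {d. (u, v) \<in> R ^^ d}. enat d)"

(* The diameter of the vertex-edge graph, not the metric diameter of the point set.  It is 0
   for the empty polytope. *)
definition polytope_diameter :: "'a::euclidean_space set \<Rightarrow> enat" where
  "polytope_diameter P =
     (SUP u \<in> polytope_vertices P. SUP v \<in> polytope_vertices P. graph_dist (polytope_adj P) u v)"

end

theory Submission
  imports Defs
begin

text \<open>The arcs \<open>(i, i + 1)\<close> form a Hamiltonian path, and pushing all flow onto it gives one vertex of
  the polytope. Every vertex reaches this one in at most \<open>n - 1\<close> simplex pivots: let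
  \<open>(1, 2), (2, 3), \<dots>\<close> enter the basis in this order. When \<open>(i, i + 1)\<close> enters, the path on
  \<open>{1..i}\<close> is already in the basis, so the cycle it closes leaves \<open>{i + 1..n}\<close> backwards along one
  basis arc and returns to \<open>i\<close> forwards along the path. Hence no path arc up to \<open>i\<close> loses flow, and
  none of them leaves the basis. Any two vertices are therefore at distance at most \<open>2 (n - 1)\<close>,
  and there are at least \<open>n - 1\<close> arcs.\<close>

section \<open>Divergence of arc vectors and forests\<close>

definition divergence :: "('e::finite \<Rightarrow> 'v \<times> 'v) \<Rightarrow> real ^ 'e \<Rightarrow> 'v \<Rightarrow> real" where
  "divergence ends x v = (\<Sum>e | fst (ends e) = v. x $ e) - (\<Sum>e | snd (ends e) = v. x $ e)"

text \<open>Acyclicity in the undirected sense: \<open>T\<close> is a forest iff it carries no nonzero circulation.\<close>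

definition acyclic_arcs :: "'v set \<Rightarrow> ('e::finite \<Rightarrow> 'v \<times> 'v) \<Rightarrow> 'e set \<Rightarrow> bool" where
  "acyclic_arcs N ends T \<longleftrightarrow>
     (\<forall>z. (\<forall>v\<in>N. divergence ends z v = 0) \<longrightarrow> (\<forall>e. e \<notin> T \<longrightarrow> z $ e = 0) \<longrightarrow> z = 0)"

lemma divergence_alt:
  "divergence ends x v =
     (\<Sum>e\<in>UNIV. x $ e * (of_bool (fst (ends e) = v) - of_bool (snd (ends e) = v)))"
proof -
  have "(\<Sum>e | P e. x $ e) = (\<Sum>e\<in>UNIV. x $ e * of_bool (P e))" for P
    by (simp add: sum.If_cases of_bool_def if_distrib cong: if_cong)
  then show ?thesis
    by (simp add: divergence_def right_diff_distrib sum_subtractf)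
qed

lemma divergence_add: "divergence ends (x + y) v = divergence ends x v + divergence ends y v"
  by (simp add: divergence_alt sum.distrib distrib_right)

lemma divergence_scaleR: "divergence ends (c *\<^sub>R x) v = c * divergence ends x v"
  by (simp add: divergence_alt sum_distrib_left mult.assoc)

lemma divergence_diff: "divergence ends (x - y) v = divergence ends x v - divergence ends y v"
  using divergence_add[of ends "x - y" y v] by simp

lemma divergence_zero [simp]: "divergence ends 0 v = 0"
  by (simp add: divergence_alt)

lemma axis_one_nth: "axis e 1 $ f = (of_bool (f = e) :: real)"
  by (simp add: axis_def)

lemma divergence_axis:
  "divergence ends (axis e 1) v = of_bool (fst (ends e) = v) - of_bool (snd (ends e) = v)"
  by (simp add: divergence_alt axis_def if_distrib[of "\<lambda>t. t * _"] cong: if_cong)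

text \<open>Arcs with both ends in \<open>C\<close> or both ends outside cancel, so only the arcs
  across the cut remain, signed by their direction.\<close>

lemma sum_divergence:
  assumes "finite C"
  shows "(\<Sum>v\<in>C. divergence ends x v) =
     (\<Sum>e\<in>UNIV. x $ e * (of_bool (fst (ends e) \<in> C) - of_bool (snd (ends e) \<in> C)))"
proof -
  have *: "(\<Sum>v\<in>C. of_bool (a = v)) = (of_bool (a \<in> C) :: real)" for a
    using assms by (simp add: of_bool_def)
  show ?thesis
    unfolding divergence_alt
    by (subst sum.swap) (simp add: sum_distrib_left[symmetric] sum_subtractf *)
qed

lemma flow_polytope_iff:
  "x \<in> flow_polytope N ends b \<longleftrightarrow> (\<forall>e. 0 \<le> x $ e) \<and> (\<forall>v\<in>N. divergence ends x v = b v)"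
  by (simp add: flow_polytope_def divergence_def)

lemma acyclic_arcsD:
  assumes "acyclic_arcs N ends T" "\<And>v. v \<in> N \<Longrightarrow> divergence ends z v = 0"
    "\<And>e. e \<notin> T \<Longrightarrow> z $ e = 0"
  shows "z = 0"
  using assms unfolding acyclic_arcs_def by blast

section \<open>Unit flows along directed and undirected paths\<close>

text \<open>One unit is sent along the path, adding 1 for each traversal of an arc. The sign of
  \<open>h\<close> is what later keeps spine arcs from losing flow in a pivot.\<close>

lemma path_flow:
  assumes "(v, w) \<in> (ends ` S)\<^sup>*"
  obtains h where "\<And>e. 0 \<le> h $ e" "\<And>e. e \<notin> S \<Longrightarrow> h $ e = 0"
    "\<And>x. divergence ends h x = of_bool (v = x) - of_bool (w = x)"
proof -
  from assms have "\<exists>h. (\<forall>e. 0 \<le> h $ e) \<and> (\<forall>e. e \<notin> S \<longrightarrow> h $ e = 0) \<and>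
    (\<forall>x. divergence ends h x = of_bool (v = x) - of_bool (w = x))"
  proof (induction rule: rtrancl_induct)
    case base
    then show ?case by (intro exI[of _ 0]) simp
  next
    case (step y z)
    then obtain h e where "\<forall>e. 0 \<le> h $ e" "\<forall>e. e \<notin> S \<longrightarrow> h $ e = 0"
      "\<forall>x. divergence ends h x = of_bool (v = x) - of_bool (y = x)"
      "e \<in> S" "ends e = (y, z)" by force
    then show ?case
      by (intro exI[of _ "h + axis e 1"])
        (auto simp: divergence_add divergence_axis axis_one_nth)
  qed
  with that show ?thesis by blast
qed

text \<open>An arc traversed backwards contributes -1, so here nothing can be said about the sign of
  \<open>h\<close>.\<close>

lemma undirected_path_flow:
  assumes "(v, w) \<in> (ends ` S \<union> (ends ` S)\<inverse>)\<^sup>*"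
  obtains h where "\<And>e. e \<notin> S \<Longrightarrow> h $ e = 0"
    "\<And>x. divergence ends h x = of_bool (v = x) - of_bool (w = x)"
proof -
  from assms have "\<exists>h. (\<forall>e. e \<notin> S \<longrightarrow> h $ e = 0) \<and>
    (\<forall>x. divergence ends h x = of_bool (v = x) - of_bool (w = x))"
  proof (induction rule: rtrancl_induct)
    case base
    then show ?case by (intro exI[of _ 0]) simp
  next
    case (step y z)
    then obtain h where h: "\<forall>e. e \<notin> S \<longrightarrow> h $ e = 0"
      "\<forall>x. divergence ends h x = of_bool (v = x) - of_bool (y = x)" by blast
    from step(2) consider e where "e \<in> S" "ends e = (y, z)" | e where "e \<in> S" "ends e = (z, y)"
      by force
    then show ?case
    proof cases
      case (1 e)
      with h show ?thesis
        by (intro exI[of _ "h + axis e 1"])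
          (auto simp: divergence_add divergence_axis axis_one_nth)
    next
      case (2 e)
      with h show ?thesis
        by (intro exI[of _ "h - axis e 1"])
          (auto simp: divergence_diff divergence_axis axis_one_nth)
    qed
  qed
  with that show ?thesis by blast
qed

section \<open>Vertices, faces and edges of the flow polytope\<close>

text \<open>A nonzero circulation on the support, scaled down, could be both added to
  \<open>u\<close> and subtracted from it, making \<open>u\<close> the midpoint of a segment in the
  polytope.\<close>

lemma vertex_support_acyclic:
  assumes "u \<in> polytope_vertices (flow_polytope N ends b)"
  shows "acyclic_arcs N ends {e. u $ e \<noteq> 0}"
  unfolding acyclic_arcs_def
proof (intro allI impI)
  fix z assume z: "\<forall>v\<in>N. divergence ends z v = 0" "\<forall>e. e \<notin> {e. u $ e \<noteq> 0} \<longrightarrow> z $ e = 0"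
  have u: "u extreme_point_of flow_polytope N ends b" "u \<in> flow_polytope N ends b"
    using assms by (auto simp: polytope_vertices_def extreme_point_of_def)
  have u0: "0 \<le> u $ e" for e using u(2) by (simp add: flow_polytope_iff)
  show "z = 0"
  proof (rule ccontr)
    assume "z \<noteq> 0"
    \<comment> \<open>The scaling factor must work for all arcs at once; it is built arc by arc as a
      minimum of ratios. Arcs with \<open>z $ e = 0\<close> impose no bound.\<close>
    have "\<exists>\<epsilon>>0. \<forall>e\<in>F. \<epsilon> * \<bar>z $ e\<bar> \<le> u $ e" if "finite F" for F
      using that
    proof induction
      case (insert e F)
      then obtain \<epsilon> where \<epsilon>: "\<epsilon> > 0" "\<forall>e\<in>F. \<epsilon> * \<bar>z $ e\<bar> \<le> u $ e" by blast
      show ?case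
      proof (cases "z $ e = 0")
        case True
        with \<epsilon> u0 show ?thesis by auto
      next
        case False
        with z u0[of e] have pos: "u $ e > 0" by (metis less_eq_real_def mem_Collect_eq)
        let ?\<delta> = "min \<epsilon> (u $ e / \<bar>z $ e\<bar>)"
        have "?\<delta> * \<bar>z $ f\<bar> \<le> u $ f" if "f \<in> F" for f
          using \<epsilon> that by (meson abs_ge_zero min.cobounded1 mult_right_mono order_trans)
        moreover have "?\<delta> * \<bar>z $ e\<bar> \<le> u $ e"
          using False by (simp add: min_def field_simps)
        moreover have "?\<delta> > 0" using \<epsilon> pos False by simp
        ultimately show ?thesis by blast
      qed
    qed (auto intro: exI[of _ 1])
    from this[of UNIV] obtain \<epsilon> where \<epsilon>: "\<epsilon> > 0" "\<And>e. \<epsilon> * \<bar>z $ e\<bar> \<le> u $ e" by auto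
    have "- u $ e \<le> \<epsilon> * z $ e \<and> \<epsilon> * z $ e \<le> u $ e" for e
      using \<epsilon>(2)[of e] \<epsilon>(1) abs_le_iff[of "\<epsilon> * z $ e" "u $ e"] by (simp add: abs_mult)
    then have "0 \<le> u $ e + \<epsilon> * z $ e" "0 \<le> u $ e - \<epsilon> * z $ e" for e
      by (smt (verit))+
    then have "u + \<epsilon> *\<^sub>R z \<in> flow_polytope N ends b" "u - \<epsilon> *\<^sub>R z \<in> flow_polytope N ends b"
      using u(2) z by (auto simp: flow_polytope_iff divergence_add divergence_diff divergence_scaleR)
    moreover have "u \<in> open_segment (u + \<epsilon> *\<^sub>R z) (u - \<epsilon> *\<^sub>R z)"
    proof -
      have "u = midpoint (u + \<epsilon> *\<^sub>R z) (u - \<epsilon> *\<^sub>R z)"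
        by (simp add: midpoint_def flip: scaleR_2)
      moreover have "u + \<epsilon> *\<^sub>R z \<noteq> u - \<epsilon> *\<^sub>R z"
      proof
        assume "u + \<epsilon> *\<^sub>R z = u - \<epsilon> *\<^sub>R z"
        then have "(u + \<epsilon> *\<^sub>R z) - (u - \<epsilon> *\<^sub>R z) = 0" by simp
        then have "(2 * \<epsilon>) *\<^sub>R z = 0" by (simp add: scaleR_2 flip: scaleR_scaleR)
        with \<epsilon> \<open>z \<noteq> 0\<close> show False by simp
      qed
      ultimately show ?thesis by (metis midpoint_in_open_segment)
    qed
    ultimately show False using u(1) by (auto simp: extreme_point_of_def)
  qed
qed

text \<open>If a proper convex combination of nonnegative numbers is zero, both numbers are
  zero.\<close>

lemma face_of_flow_polytope:
  "{x \<in> flow_polytope N ends b. \<forall>e. e \<notin> T \<longrightarrow> x $ e = 0} face_of flow_polytope N ends b"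
  (is "?F face_of ?P")
proof -
  have conv: "convex ?P"
    unfolding convex_def
    by (auto simp: flow_polytope_iff divergence_add divergence_scaleR simp flip: distrib_right)
  have "convex ?F"
    using conv unfolding convex_alt by auto
  moreover have "x \<in> ?F \<and> y \<in> ?F"
    if xy: "x \<in> ?P" "y \<in> ?P" and w: "w \<in> ?F" "w \<in> open_segment x y" for x y w
  proof -
    from w(2) obtain t where t: "0 < t" "t < 1" "w = (1 - t) *\<^sub>R x + t *\<^sub>R y"
      by (auto simp: in_segment)
    have "x $ e = 0 \<and> y $ e = 0" if "e \<notin> T" for e
    proof -
      have "(1 - t) * x $ e + t * y $ e = 0" using that w(1) t(3) by auto
      moreover have "0 \<le> (1 - t) * x $ e" "0 \<le> t * y $ e"
        using xy t by (auto simp: flow_polytope_iff)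
      ultimately have "(1 - t) * x $ e = 0" "t * y $ e = 0" by linarith+
      with t show ?thesis by simp
    qed
    with xy show ?thesis by simp
  qed
  ultimately show ?thesis unfolding face_of_def by blast
qed

text \<open>Two points of the polytope supported in the forest \<open>T\<close> differ by a
  circulation on \<open>T\<close>, hence coincide: the face cut out by \<open>T\<close> is a single
  point.\<close>

lemma acyclic_support_vertex:
  assumes "acyclic_arcs N ends T" "u \<in> flow_polytope N ends b" "\<And>e. e \<notin> T \<Longrightarrow> u $ e = 0"
  shows "u \<in> polytope_vertices (flow_polytope N ends b)"
proof -
  have "x = u" if "x \<in> flow_polytope N ends b" "\<And>e. e \<notin> T \<Longrightarrow> x $ e = 0" for x
    using acyclic_arcsD[OF assms(1), of "x - u"] that assms(2,3)
    by (simp add: flow_polytope_iff divergence_diff)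
  then have "{x \<in> flow_polytope N ends b. \<forall>e. e \<notin> T \<longrightarrow> x $ e = 0} = {u}"
    using assms(2,3) by (intro equalityI subsetI) blast+
  with face_of_flow_polytope[of N ends b T] show ?thesis
    by (simp add: polytope_vertices_def face_of_singleton)
qed

text \<open>A simplex pivot: the entering arc \<open>m\<close> closes the cycle \<open>h\<close>, and a leaving arc \<open>f\<close> is one
  where \<open>h\<close> blocks first. A degenerate pivot leaves the vertex unchanged.\<close>

lemma pivot:
  assumes T: "acyclic_arcs N ends T" and u: "u \<in> flow_polytope N ends b"
    and supp: "\<And>e. e \<notin> T \<Longrightarrow> u $ e = 0" and m: "m \<notin> T"
    and h: "\<And>v. v \<in> N \<Longrightarrow> divergence ends h v = 0" "\<And>e. e \<notin> insert m T \<Longrightarrow> h $ e = 0" "h $ m = 1"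
    and neg: "h $ e0 < 0"
  obtains f w where "h $ f < 0" "acyclic_arcs N ends (insert m T - {f})"
    "w \<in> flow_polytope N ends b" "\<And>e. e \<notin> insert m T - {f} \<Longrightarrow> w $ e = 0"
    "w = u \<or> (u, w) \<in> polytope_adj (flow_polytope N ends b)"
proof -
  let ?P = "flow_polytope N ends b"
  let ?r = "\<lambda>e. u $ e / - h $ e"
  \<comment> \<open>The ratio test: \<open>t\<close> is the largest step along \<open>h\<close> that
    keeps all coordinates nonnegative.\<close>
  define t where "t = Min (?r ` {e. h $ e < 0})"
  have fin: "finite (?r ` {e. h $ e < 0})" "?r ` {e. h $ e < 0} \<noteq> {}" using neg by auto
  from Min_in[OF fin] obtain f where f: "h $ f < 0" "t = ?r f" unfolding t_def by blast
  have u0: "0 \<le> u $ e" for e using u by (simp add: flow_polytope_iff)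
  have t0: "0 \<le> t" using f u0[of f] by (simp add: divide_le_0_iff)
  define w where "w = u + t *\<^sub>R h"
  have wf: "w $ f = 0" using f by (simp add: w_def)
  have "0 \<le> w $ e" for e
  proof (cases "h $ e < 0")
    case True
    then have "t \<le> ?r e" unfolding t_def using fin by (intro Min_le) auto
    with True show ?thesis by (simp add: w_def field_simps)
  next
    case False
    with t0 u0[of e] show ?thesis by (simp add: w_def)
  qed
  then have w: "w \<in> ?P" using u h(1) by (simp add: flow_polytope_iff w_def divergence_add divergence_scaleR)
  have wsupp: "w $ e = 0" if "e \<notin> insert m T - {f}" for e
    using that supp[of e] h(2)[of e] wf by (auto simp: w_def)
  \<comment> \<open>Circulations on \<open>insert m T\<close> form the line spanned by
    \<open>h\<close>, because subtracting \<open>z $ m\<close> times \<open>h\<close> leaves a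
    circulation on the forest \<open>T\<close>. This yields both the acyclicity after removing
    \<open>f\<close> and the dimension of the face containing \<open>u\<close> and
    \<open>w\<close>.\<close>
  have multiple: "z = z $ m *\<^sub>R h"
    if "\<And>v. v \<in> N \<Longrightarrow> divergence ends z v = 0" "\<And>e. e \<notin> insert m T \<Longrightarrow> z $ e = 0" for z
  proof -
    have "z - z $ m *\<^sub>R h = 0"
    proof (rule acyclic_arcsD[OF T])
      show "(z - z $ m *\<^sub>R h) $ e = 0" if "e \<notin> T" for e
        using that \<open>\<And>e. e \<notin> insert m T \<Longrightarrow> z $ e = 0\<close>[of e] h(2)[of e] h(3)
        by (cases "e = m") auto
    qed (use that h in \<open>simp add: divergence_diff divergence_scaleR\<close>)
    then show ?thesis by simp
  qed
  have acyc: "acyclic_arcs N ends (insert m T - {f})"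
    unfolding acyclic_arcs_def
  proof (intro allI impI)
    fix z assume z: "\<forall>v\<in>N. divergence ends z v = 0" "\<forall>e. e \<notin> insert m T - {f} \<longrightarrow> z $ e = 0"
    then have eq: "z = z $ m *\<^sub>R h" by (intro multiple) auto
    have "z $ f = 0" using z by auto
    then have "z $ m * h $ f = 0" using arg_cong[OF eq, of "\<lambda>z. z $ f"] by simp
    with f eq show "z = 0" by auto
  qed
  have "(u, w) \<in> polytope_adj ?P" if "w \<noteq> u"
  proof -
    have "closed_segment u w = {x \<in> ?P. \<forall>e. e \<notin> insert m T \<longrightarrow> x $ e = 0}" (is "_ = ?F")
    proof
      show "closed_segment u w \<subseteq> ?F"
      proof (rule closed_segment_subset)
        show "convex ?F" using face_of_imp_convex face_of_flow_polytope by blast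
      qed (use u w wsupp supp in auto)
    next
      show "?F \<subseteq> closed_segment u w"
      proof
        fix x assume x: "x \<in> ?F"
        have eq: "x - u = (x - u) $ m *\<^sub>R h"
          using x u supp by (intro multiple) (auto simp: flow_polytope_iff divergence_diff)
        \<comment> \<open>As \<open>u $ m = 0\<close> and \<open>h $ m = 1\<close>, coordinate
          \<open>m\<close> measures the step from \<open>u\<close>. Nonnegativity on
          \<open>m\<close> gives \<open>0 \<le> s\<close>, and on \<open>f\<close> it gives
          \<open>s \<le> t\<close>.\<close>
        define s where "s = x $ m"
        have xs: "x = u + s *\<^sub>R h" using eq supp[OF m] by (simp add: s_def algebra_simps)
        have s0: "0 \<le> s" using x by (auto simp: s_def flow_polytope_iff)
        have "0 \<le> x $ f" using x by (auto simp: flow_polytope_iff)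
        then have "s \<le> t" using f(1) unfolding f(2) by (subst pos_le_divide_eq) (auto simp: xs)
        moreover have "t \<noteq> 0" using that w_def by auto
        ultimately have "0 \<le> s / t" "s / t \<le> 1" using s0 t0 by auto
        moreover have "x = (1 - s / t) *\<^sub>R u + (s / t) *\<^sub>R w"
          using \<open>t \<noteq> 0\<close> by (simp add: xs w_def scaleR_left_diff_distrib scaleR_add_right)
        ultimately show "x \<in> closed_segment u w" by (auto simp: in_segment)
      qed
    qed
    then have "closed_segment u w face_of ?P"
      using face_of_flow_polytope[of N ends b "insert m T"] by simp
    moreover have "aff_dim (closed_segment u w) = 1"
      using that by (simp add: segment_convex_hull aff_dim_convex_hull aff_dim_2)
    ultimately show ?thesis
      using acyclic_support_vertex[OF T u supp] acyclic_support_vertex[OF acyc w wsupp]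
      by (simp add: polytope_adj_def edge_of_def)
  qed
  with that f(1) acyc w wsupp show ?thesis by blast
qed

lemma sym_relpow:
  assumes "sym R"
  shows "sym (R ^^ d)"
proof (induction d)
  case (Suc d)
  with assms have "(R ^^ Suc d)\<inverse> = R ^^ Suc d"
    by (simp add: converse_relcomp sym_conv_converse_eq relpow_commute)
  then show ?case by (simp add: sym_conv_converse_eq)
qed (auto simp: sym_def)

lemma sym_polytope_adj: "sym (polytope_adj P)"
  by (auto simp: sym_def polytope_adj_def closed_segment_commute)

section \<open>Walks to the Hamiltonian path in a topologically numbered graph\<close>

locale hamiltonian_dag =
  fixes n :: nat and ends :: "'e::finite \<Rightarrow> nat \<times> nat"
  assumes inj_ends: "inj ends"
    and ends_bounds: "1 \<le> fst (ends e)" "fst (ends e) < snd (ends e)" "snd (ends e) \<le> n"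
    and hamiltonian: "\<lbrakk>1 \<le> i; i < n\<rbrakk> \<Longrightarrow> (i, Suc i) \<in> range ends"
begin

text \<open>The initial piece of the Hamiltonian path that must already be in the basis after
  \<open>i\<close> rounds; it covers the nodes up to \<open>Suc i\<close>.\<close>

definition spine :: "nat \<Rightarrow> 'e set" where
  "spine i = {e. snd (ends e) = Suc (fst (ends e)) \<and> fst (ends e) \<le> i}"

lemma spine_reachable:
  assumes "a \<le> c" "1 \<le> a" "c \<le> n" "c \<le> Suc i"
  shows "(a, c) \<in> (ends ` spine i)\<^sup>*"
  using assms
proof (induction c rule: dec_induct)
  case (step c)
  then obtain e where "ends e = (c, Suc c)" using hamiltonian[of c] by auto
  then have "(c, Suc c) \<in> ends ` spine i"
    using step by (intro image_eqI[of _ _ e]) (auto simp: spine_def)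
  with step show ?case by (auto intro: rtrancl_into_rtrancl)
qed simp

text \<open>Any further arc would close a cycle with the part of the path between its ends. Hence
  all walks end with the same basis.\<close>

lemma acyclic_spine_unique:
  assumes "acyclic_arcs {1..n} ends T" "spine n \<subseteq> T"
  shows "T = spine n"
proof -
  have False if e: "e \<in> T" "e \<notin> spine n" for e
  proof -
    obtain h where h: "\<And>e. 0 \<le> h $ e" "\<And>e. e \<notin> spine n \<Longrightarrow> h $ e = 0"
      "\<And>x. divergence ends h x = of_bool (fst (ends e) = x) - of_bool (snd (ends e) = x)"
      using path_flow[OF spine_reachable[of "fst (ends e)" "snd (ends e)" n]] ends_bounds[of e]
      by (metis le_Suc_eq less_imp_le)
    have "h - axis e 1 = 0"
      using assms e h by (intro acyclic_arcsD[OF assms(1)])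
        (auto simp: divergence_diff divergence_axis axis_one_nth)
    then have "h $ e = 1" by (simp add: vec_eq_iff axis_one_nth)
    with h e show False by simp
  qed
  with assms show ?thesis by blast
qed

text \<open>If the next path arc \<open>m\<close> closes a cycle with \<open>T\<close>, a pivot
  brings it in; otherwise \<open>insert m T\<close> is still a forest and \<open>u\<close> stays.
  The second case can arise because \<open>T\<close> need not be a spanning tree.\<close>

lemma spine_pivot:
  assumes T: "acyclic_arcs {1..n} ends T" and u: "u \<in> flow_polytope {1..n} ends b"
    and supp: "\<And>e. e \<notin> T \<Longrightarrow> u $ e = 0" and spine: "spine i \<subseteq> T" and i: "Suc i < n"
  obtains T' w where "acyclic_arcs {1..n} ends T'" "w \<in> flow_polytope {1..n} ends b"
    "\<And>e. e \<notin> T' \<Longrightarrow> w $ e = 0" "spine (Suc i) \<subseteq> T'"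
    "w = u \<or> (u, w) \<in> polytope_adj (flow_polytope {1..n} ends b)"
proof -
  let ?j = "Suc i"
  obtain m where m: "ends m = (?j, Suc ?j)" using hamiltonian[of ?j] i by auto
  have spine_Suc: "spine ?j = insert m (spine i)"
  proof -
    have "e = m" if "snd (ends e) = Suc (fst (ends e))" "fst (ends e) = ?j" for e
      using that m inj_ends by (metis injD prod.collapse)
    then show ?thesis using m by (auto simp: spine_def le_Suc_eq)
  qed
  show thesis
  proof (cases "m \<in> T")
    case True
    with that[OF T u supp] spine spine_Suc show ?thesis by auto
  next
    case False
    \<comment> \<open>\<open>C\<close> is the component of the head of \<open>m\<close> in the part
      of the forest beyond \<open>?j\<close>. Since arcs increase, it never meets the nodes up to
      \<open>?j\<close>, which \<open>spine i\<close> connects; so \<open>m\<close> closes a cycle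
      when an arc of \<open>T\<close> enters \<open>C\<close> from those nodes.\<close>
    define S where "S = {e \<in> T. ?j < fst (ends e)}"
    define R where "R = ends ` S \<union> (ends ` S)\<inverse>"
    define C where "C = {v. (Suc ?j, v) \<in> R\<^sup>*}"
    have C_sub: "v \<in> {Suc ?j..n}" if "v \<in> C" for v
    proof -
      from that have "(Suc ?j, v) \<in> R\<^sup>*" by (simp add: C_def)
      then show ?thesis
      proof (induction rule: rtrancl_induct)
        case (step y z)
        from step(2) obtain e where "e \<in> S" "ends e = (y, z) \<or> ends e = (z, y)"
          unfolding R_def by force
        then show ?case using ends_bounds[of e] by (auto simp: S_def)
      qed (use i in auto)
    qed
    have C_closed: "fst (ends e) \<in> C \<longleftrightarrow> snd (ends e) \<in> C" if "e \<in> S" for e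
    proof -
      have "(fst (ends e), snd (ends e)) \<in> R" "(snd (ends e), fst (ends e)) \<in> R"
        using that by (auto simp: R_def)
      then show ?thesis by (auto simp: C_def intro: rtrancl_into_rtrancl)
    qed
    show ?thesis
    proof (cases "\<exists>e\<in>T. fst (ends e) \<le> ?j \<and> snd (ends e) \<in> C")
      case True
      then obtain e0 where e0: "e0 \<in> T" "fst (ends e0) \<le> ?j" "snd (ends e0) \<in> C" by blast
      obtain q where q: "\<And>e. e \<notin> S \<Longrightarrow> q $ e = 0"
        "\<And>x. divergence ends q x = of_bool (Suc ?j = x) - of_bool (snd (ends e0) = x)"
        using e0(3) undirected_path_flow[of "Suc ?j" "snd (ends e0)" ends S]
        unfolding C_def R_def by auto
      have "(fst (ends e0), ?j) \<in> (ends ` spine i)\<^sup>*"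
        using e0(2) ends_bounds[of e0] i by (intro spine_reachable) auto
      then obtain r where r: "\<And>e. 0 \<le> r $ e" "\<And>e. e \<notin> spine i \<Longrightarrow> r $ e = 0"
        "\<And>x. divergence ends r x = of_bool (fst (ends e0) = x) - of_bool (?j = x)"
        using path_flow by metis
      \<comment> \<open>\<open>m\<close> forwards, then \<open>q\<close> among the nodes beyond \<open>Suc i\<close>, back over \<open>e0\<close>, and \<open>r\<close> along the path to \<open>Suc i\<close>\<close>
      define h where "h = axis m 1 + q - axis e0 1 + r"
      \<comment> \<open>The possibly negative parts of \<open>h\<close> avoid the spine:
        \<open>q\<close> lives on arcs starting beyond \<open>?j\<close>, and \<open>e0\<close> ends
        beyond \<open>?j\<close>, so the only spine arc it could be is \<open>m\<close>, which is
        not in \<open>T\<close>. The leaving arc is therefore no spine arc.\<close>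
      have h_nonneg: "0 \<le> h $ e" if "e \<in> spine ?j" for e
      proof -
        have "e \<notin> S" using that by (auto simp: S_def spine_def)
        moreover have "e \<noteq> e0"
          using that e0 False C_sub[of "snd (ends e0)"] unfolding spine_Suc
          by (auto simp: spine_def)
        ultimately show ?thesis using q(1) r(1) by (simp add: h_def axis_one_nth)
      qed
      have hm: "h $ m = 1"
        using q(1)[of m] r(2)[of m] False e0(1) m by (auto simp: h_def axis_one_nth S_def spine_def)
      have he0: "h $ e0 < 0"
        using q(1)[of e0] r(2)[of e0] False e0 C_sub[of "snd (ends e0)"]
        by (auto simp: h_def axis_one_nth S_def spine_def)
      have "divergence ends h v = 0" for v
        by (simp add: h_def divergence_add divergence_diff divergence_axis q r m)
      moreover have "h $ e = 0" if "e \<notin> insert m T" for e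
        using that q(1)[of e] r(2)[of e] e0(1) spine by (auto simp: h_def axis_one_nth S_def)
      ultimately obtain f w where f: "h $ f < 0" "acyclic_arcs {1..n} ends (insert m T - {f})"
        "w \<in> flow_polytope {1..n} ends b" "\<And>e. e \<notin> insert m T - {f} \<Longrightarrow> w $ e = 0"
        "w = u \<or> (u, w) \<in> polytope_adj (flow_polytope {1..n} ends b)"
        using pivot[OF T u supp False _ _ hm he0] by metis
      have "f \<notin> spine ?j" using h_nonneg[of f] f(1) by fastforce
      then have "spine ?j \<subseteq> insert m T - {f}" using spine unfolding spine_Suc by blast
      with that f show ?thesis by blast
    next
      case none: False
      \<comment> \<open>\<open>m\<close> is then the only arc of \<open>insert m T\<close> across the cut \<open>C\<close>, so circulations vanish on it\<close>
      have "acyclic_arcs {1..n} ends (insert m T)"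
        unfolding acyclic_arcs_def
      proof (intro allI impI)
        fix z assume z: "\<forall>v\<in>{1..n}. divergence ends z v = 0" "\<forall>e. e \<notin> insert m T \<longrightarrow> z $ e = 0"
        have fin: "finite C" using C_sub by (meson finite_atLeastAtMost finite_subset subsetI)
        have mC: "fst (ends m) \<notin> C" "snd (ends m) \<in> C"
          using C_sub[of ?j] m by (auto simp: C_def)
        have summand: "z $ e * (of_bool (fst (ends e) \<in> C) - of_bool (snd (ends e) \<in> C))
            = (if e = m then - z $ m else 0)" for e
        proof -
          consider "e = m" | "e \<noteq> m" "e \<notin> T" | "e \<noteq> m" "e \<in> S" | "e \<in> T" "e \<noteq> m" "fst (ends e) \<le> ?j"
            by (force simp: S_def)
          then show ?thesis
          proof cases
            case 4
            with none C_sub[of "fst (ends e)"] show ?thesis by auto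
          qed (use mC z C_closed in auto)
        qed
        have "divergence ends z v = 0" if "v \<in> C" for v
          using z(1) C_sub[OF that] by simp
        then have "(\<Sum>v\<in>C. divergence ends z v) = 0" by (rule sum.neutral[OF ballI])
        then have zm: "z $ m = 0" unfolding sum_divergence[OF fin] summand by simp
        show "z = 0"
        proof (rule acyclic_arcsD[OF T])
          show "z $ e = 0" if "e \<notin> T" for e
            using z(2) zm that by (cases "e = m") auto
        qed (use z(1) in blast)
      qed
      with that[of "insert m T" u] u supp spine spine_Suc show ?thesis by blast
    qed
  qed
qed

text \<open>The initial forest is the support of \<open>u\<close>. Only \<open>d \<le> i\<close> is
  claimed, as a round may leave the vertex unchanged.\<close>

lemma spine_walk:
  assumes u: "u \<in> polytope_vertices (flow_polytope {1..n} ends b)" and "i < n"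
  shows "\<exists>w T. \<exists>d\<le>i. (u, w) \<in> polytope_adj (flow_polytope {1..n} ends b) ^^ d \<and>
     acyclic_arcs {1..n} ends T \<and> w \<in> flow_polytope {1..n} ends b \<and>
     (\<forall>e. e \<notin> T \<longrightarrow> w $ e = 0) \<and> spine i \<subseteq> T"
  using \<open>i < n\<close>
proof (induction i)
  case 0
  have "fst (ends e) \<noteq> 0" for e using ends_bounds(1)[of e] by simp
  then have "spine 0 = {}" by (simp add: spine_def)
  moreover have "u \<in> flow_polytope {1..n} ends b"
    using u by (simp add: polytope_vertices_def extreme_point_of_def)
  ultimately show ?case
    using vertex_support_acyclic[OF u]
    by (intro exI[of _ u] exI[of _ "{e. u $ e \<noteq> 0}"] exI[of _ 0]) auto
next
  case (Suc i)
  then obtain w T d where d: "d \<le> i" "(u, w) \<in> polytope_adj (flow_polytope {1..n} ends b) ^^ d"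
    and T: "acyclic_arcs {1..n} ends T" "w \<in> flow_polytope {1..n} ends b"
      "\<And>e. e \<notin> T \<Longrightarrow> w $ e = 0" "spine i \<subseteq> T" by auto
  from spine_pivot[OF T Suc.prems] obtain T' w' where T': "acyclic_arcs {1..n} ends T'"
      "w' \<in> flow_polytope {1..n} ends b" "\<And>e. e \<notin> T' \<Longrightarrow> w' $ e = 0" "spine (Suc i) \<subseteq> T'"
    and "w' = w \<or> (w, w') \<in> polytope_adj (flow_polytope {1..n} ends b)"
    by metis
  then have "\<exists>d'\<le>Suc i. (u, w') \<in> polytope_adj (flow_polytope {1..n} ends b) ^^ d'"
    using d by (metis Suc_le_mono le_SucI relpow_Suc_I)
  with T' show ?case by blast
qed

lemma spine_vertex_walk:
  assumes "u \<in> polytope_vertices (flow_polytope {1..n} ends b)" "1 \<le> n"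
  obtains w d where "d \<le> n - 1" "(u, w) \<in> polytope_adj (flow_polytope {1..n} ends b) ^^ d"
    "w \<in> flow_polytope {1..n} ends b" "\<And>e. e \<notin> spine n \<Longrightarrow> w $ e = 0"
    "acyclic_arcs {1..n} ends (spine n)"
proof -
  have "fst (ends e) \<le> n - 1" "fst (ends e) \<le> n" for e
    using ends_bounds[of e] by linarith+
  \<comment> \<open>No arc starts at \<open>n\<close>, so \<open>n - 1\<close> rounds already
    collect the whole path.\<close>
  then have "spine (n - 1) = spine n" by (simp add: spine_def)
  with spine_walk[OF assms(1), of "n - 1"] assms(2)
  obtain w T d where *: "d \<le> n - 1" "(u, w) \<in> polytope_adj (flow_polytope {1..n} ends b) ^^ d"
    "acyclic_arcs {1..n} ends T" "w \<in> flow_polytope {1..n} ends b"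
    "\<forall>e. e \<notin> T \<longrightarrow> w $ e = 0" "spine n \<subseteq> T" by auto
  with acyclic_spine_unique[of T] that[of d w] show ?thesis by simp
qed

text \<open>The walks from \<open>u\<close> and \<open>v\<close> end in the same vertex, since the
  path carries at most one flow with supply \<open>b\<close>; the second walk is then
  reversed.\<close>

lemma diameter_le:
  assumes "1 \<le> n"
  shows "polytope_diameter (flow_polytope {1..n} ends b) \<le> enat (2 * (n - 1))"
  unfolding polytope_diameter_def
proof (intro SUP_least)
  let ?R = "polytope_adj (flow_polytope {1..n} ends b)"
  fix u v assume "u \<in> polytope_vertices (flow_polytope {1..n} ends b)"
    "v \<in> polytope_vertices (flow_polytope {1..n} ends b)"
  then obtain w d w' d' where w: "d \<le> n - 1" "(u, w) \<in> ?R ^^ d"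
      "w \<in> flow_polytope {1..n} ends b" "\<And>e. e \<notin> spine n \<Longrightarrow> w $ e = 0"
      "acyclic_arcs {1..n} ends (spine n)"
    and w': "d' \<le> n - 1" "(v, w') \<in> ?R ^^ d'"
      "w' \<in> flow_polytope {1..n} ends b" "\<And>e. e \<notin> spine n \<Longrightarrow> w' $ e = 0"
    using spine_vertex_walk assms by metis
  have "w - w' = 0"
    using w w' by (intro acyclic_arcsD[OF w(5)]) (auto simp: flow_polytope_iff divergence_diff)
  then have "(w, v) \<in> ?R ^^ d'"
    using w'(2) sym_relpow[OF sym_polytope_adj] by (auto dest: symD)
  with w(2) have "(u, v) \<in> ?R ^^ (d + d')" by (auto simp: relpow_add)
  then have "graph_dist ?R u v \<le> enat (d + d')"
    unfolding graph_dist_def by (intro INF_lower) simp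
  also have "\<dots> \<le> enat (2 * (n - 1))" using w(1) w'(1) by simp
  finally show "graph_dist ?R u v \<le> enat (2 * (n - 1))" .
qed

end

section \<open>The band graph\<close>

theorem theorem3p33:
  fixes n k :: nat
    and ends :: "'e::finite \<Rightarrow> nat \<times> nat"
    and b :: "nat \<Rightarrow> real"
  assumes "1 \<le> k" and "k < n"
    and "bij_betw ends UNIV (band_arcs n k)"
  shows "polytope_diameter (flow_polytope (band_nodes n) ends b) \<le> enat (2 * card (band_arcs n k))"
proof -
  have range: "range ends = band_arcs n k" and "inj ends"
    using assms(3) by (auto simp: bij_betw_def)
  have "1 \<le> fst (ends e) \<and> fst (ends e) < snd (ends e) \<and> snd (ends e) \<le> n" for e
  proof -
    have "ends e \<in> band_arcs n k" using range by blast
    then show ?thesis by (cases "ends e") (auto simp: band_arcs_def)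
  qed
  moreover have path: "(i, Suc i) \<in> band_arcs n k" if "1 \<le> i" "i < n" for i
    using that assms(1) by (simp add: band_arcs_def)
  ultimately interpret hamiltonian_dag n ends
    using \<open>inj ends\<close> range by unfold_locales auto
  \<comment> \<open>The path itself supplies \<open>n - 1\<close> distinct arcs, which turns the
    bound in nodes into one in arcs.\<close>
  have "n - 1 = card ((\<lambda>i. (i, Suc i)) ` {1..<n})"
    by (simp add: card_image inj_on_def)
  also have "\<dots> \<le> card (band_arcs n k)"
  proof (rule card_mono)
    show "finite (band_arcs n k)" using finite_imageI[of UNIV ends] range by simp
  qed (use path in auto)
  finally have "enat (2 * (n - 1)) \<le> enat (2 * card (band_arcs n k))" by simp
  moreover have "1 \<le> n" using assms by simp
  ultimately show ?thesis
    unfolding band_nodes_def by (meson diameter_le order_trans)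
qed

end
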